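(* Let $(X,d)$ be a semimetric space with triangle function $\Phi_1$, let $(Y,\rho)$ be a semimetric space, and let $f\colon X\to Y$ be a surjective $\eta$-quasisymmetric mapping. Suppose that the following conditions hold for $\Phi_1$ and for some function $\Phi_2\colon \mathbb{R}^+\times\mathbb{R}^+\to\mathbb{R}^+$: (i) $\Phi_2$ is symmetric, monotone increasing in both of its arguments and satisfies $\Phi_2(0,0)=0$; (ii) $\lambda\Phi_1(x,y)\leqslant \Phi_1(\lambda x,\lambda y)$ and $\Phi_2(\lambda x,\lambda y)\leqslant \lambda\Phi_2(x,y)$ for all $\lambda>0$ and all $x,y\in\mathbb{R}^+$; (iii) for all $t_1,t_2\in\mathbb{R}^+\setminus\{0\}$, the inequality $1\leqslant \Phi_1\left(\frac{1}{t_1},\frac{1}{t_2}\right)$ implies $1\leqslant \Phi_2\left(\frac{1}{\eta(t_1)},\frac{1}{\eta(t_2)}\right)$; (iv) $a\leqslant \Phi_2(a,0)$ for all $a>0$. Then $\Phi_2$ is a triangle function for the space $(Y,\rho)$.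
   Context: $\mathbb{R}^+=[0,\infty)$. A semimetric on a nonempty set $X$ is a function $d\colon X\times X\to\mathbb{R}^+$ with $d(x,y)=0\Leftrightarrow x=y$ and $d(x,y)=d(y,x)$; then $(X,d)$ is a semimetric space. A function $\Phi\colon\mathbb{R}^+\times\mathbb{R}^+\to\mathbb{R}^+$ is a triangle function for a semimetric $d$ on $X$ (or for $(X,d)$) if $\Phi$ is symmetric, monotone increasing (in the non-strict sense) in both of its arguments, satisfies $\Phi(0,0)=0$, and $d(x,y)\leqslant\Phi(d(x,z),d(y,z))$ for all $x,y,z\in X$. Let $\eta\colon[0,\infty)\to[0,\infty)$ be a homeomorphism. A mapping $f\colon X\to Y$ between semimetric spaces $(X,d)$, $(Y,\rho)$ is $\eta$-quasisymmetric if $d(x,a)\leqslant t\,d(x,b)$ implies $\rho(f(x),f(a))\leqslant\eta(t)\rho(f(x),f(b))$ for all $a,b,x\in X$ and all $t>0$. No continuity of $f$ is assumed. *)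

theory Defs
  imports "HOL-Analysis.Analysis"
begin

text \<open>
  Semimetric spaces are given by a carrier set and a distance function that is constrained
  only on the carrier. The half-line \<open>[0,\<infinity>)\<close> is the set \<open>{0..}\<close> of reals; functions on it or
  on its square are real functions constrained only there.
\<close>

definition semimetric_space :: "'a set \<Rightarrow> ('a \<Rightarrow> 'a \<Rightarrow> real) \<Rightarrow> bool" where
  "semimetric_space X d \<longleftrightarrow>
     X \<noteq> {} \<and>
     (\<forall>x\<in>X. \<forall>y\<in>X. 0 \<le> d x y) \<and>
     (\<forall>x\<in>X. \<forall>y\<in>X. d x y = 0 \<longleftrightarrow> x = y) \<and>
     (\<forall>x\<in>X. \<forall>y\<in>X. d x y = d y x)"

definition half_line_binary :: "(real \<Rightarrow> real \<Rightarrow> real) \<Rightarrow> bool" where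
  "half_line_binary \<Phi> \<longleftrightarrow> (\<forall>x\<in>{0..}. \<forall>y\<in>{0..}. \<Phi> x y \<in> {0..})"

definition sym_mono_zero :: "(real \<Rightarrow> real \<Rightarrow> real) \<Rightarrow> bool" where
  "sym_mono_zero \<Phi> \<longleftrightarrow>
     (\<forall>x\<in>{0..}. \<forall>y\<in>{0..}. \<Phi> x y = \<Phi> y x) \<and>
     (\<forall>y\<in>{0..}. mono_on {0..} (\<lambda>x. \<Phi> x y)) \<and>
     (\<forall>x\<in>{0..}. mono_on {0..} (\<lambda>y. \<Phi> x y)) \<and>
     \<Phi> 0 0 = 0"

definition triangle_function ::
    "'a set \<Rightarrow> ('a \<Rightarrow> 'a \<Rightarrow> real) \<Rightarrow> (real \<Rightarrow> real \<Rightarrow> real) \<Rightarrow> bool" where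
  "triangle_function X d \<Phi> \<longleftrightarrow>
     half_line_binary \<Phi> \<and> sym_mono_zero \<Phi> \<and>
     (\<forall>x\<in>X. \<forall>y\<in>X. \<forall>z\<in>X. d x y \<le> \<Phi> (d x z) (d y z))"

definition quasisymmetric ::
    "(real \<Rightarrow> real) \<Rightarrow> 'a set \<Rightarrow> ('a \<Rightarrow> 'a \<Rightarrow> real) \<Rightarrow> 'b set \<Rightarrow> ('b \<Rightarrow> 'b \<Rightarrow> real)
       \<Rightarrow> ('a \<Rightarrow> 'b) \<Rightarrow> bool" where
  "quasisymmetric \<eta> X d Y \<rho> f \<longleftrightarrow>
     f \<in> X \<rightarrow> Y \<and>
     (\<forall>a\<in>X. \<forall>b\<in>X. \<forall>x\<in>X. \<forall>t>0.
        d x a \<le> t * d x b \<longrightarrow> \<rho> (f x) (f a) \<le> \<eta> t * \<rho> (f x) (f b))"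

end

theory Submission
  imports Defs
begin

text \<open>
  For points whose images are distinct, divide the triangle inequality for \<open>d\<close> by \<open>d x y\<close>: it
  becomes \<open>1 \<le> \<Phi>1 (1 / t1) (1 / t2)\<close> with \<open>t1 = d x y / d x z\<close>, \<open>t2 = d x y / d y z\<close>. The
  hypothesis linking \<open>\<Phi>1\<close> to \<open>\<Phi>2\<close> transfers this to \<open>\<Phi>2\<close>, quasisymmetry bounds
  \<open>1 / \<eta> t1\<close> and \<open>1 / \<eta> t2\<close> by ratios of \<open>\<rho>\<close>-distances, and scaling \<open>\<Phi>2\<close> back by the
  distance of the images gives the triangle inequality for \<open>\<rho>\<close>.
\<close>

lemma sym_mono_zero_mono:
  assumes "sym_mono_zero \<Phi>" "0 \<le> x" "x \<le> x'" "0 \<le> y" "y \<le> y'"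
  shows "\<Phi> x y \<le> \<Phi> x' y'"
proof -
  have "mono_on {0..} (\<lambda>u. \<Phi> u y)" "mono_on {0..} (\<lambda>v. \<Phi> x' v)"
    using assms by (auto simp: sym_mono_zero_def)
  then have "\<Phi> x y \<le> \<Phi> x' y" "\<Phi> x' y \<le> \<Phi> x' y'"
    using assms(2-5) by (auto elim!: mono_onD)
  then show ?thesis by linarith
qed

text \<open>Quasisymmetry is used at the ratio \<open>t = d x a / d x b\<close>, where its premise
  holds with equality. The positivity claim supplies the nonnegative arguments that monotonicity on
  the half-line requires.\<close>

lemma quasisymmetric_inverse_le:
  assumes "semimetric_space X d" "semimetric_space Y \<rho>" "quasisymmetric \<eta> X d Y \<rho> f"
    and "x \<in> X" "a \<in> X" "b \<in> X" "f x \<noteq> f a" "f x \<noteq> f b"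
  shows "0 < 1 / \<eta> (d x a / d x b)"
    and "1 / \<eta> (d x a / d x b) \<le> \<rho> (f x) (f b) / \<rho> (f x) (f a)"
proof -
  have "f \<in> X \<rightarrow> Y"
    using assms(3) by (simp add: quasisymmetric_def)
  \<comment> \<open>Distinct images come from distinct points, so no distance vanishes on either
    side.\<close>
  then have pos: "0 < d x a" "0 < d x b" "0 < \<rho> (f x) (f a)" "0 < \<rho> (f x) (f b)"
    using assms unfolding semimetric_space_def by (metis PiE less_eq_real_def)+
  let ?t = "d x a / d x b"
  have "0 < ?t" "d x a \<le> ?t * d x b"
    using pos by auto
  then have le: "\<rho> (f x) (f a) \<le> \<eta> ?t * \<rho> (f x) (f b)"
    using assms(3-6) unfolding quasisymmetric_def by blast
  \<comment> \<open>Positivity of \<open>\<eta> ?t\<close> is forced by the inequality itself, whose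
    left side is positive.\<close>
  then have "0 < \<eta> ?t * \<rho> (f x) (f b)"
    using pos by linarith
  then have eta: "0 < \<eta> ?t"
    using pos by (simp add: zero_less_mult_iff)
  then show "0 < 1 / \<eta> ?t" by simp
  show "1 / \<eta> ?t \<le> \<rho> (f x) (f b) / \<rho> (f x) (f a)"
    using le pos(3) eta by (simp add: divide_le_eq le_divide_eq mult.commute)
qed

theorem theorem3p1:
  fixes X :: "'a set" and d :: "'a \<Rightarrow> 'a \<Rightarrow> real"
    and Y :: "'b set" and \<rho> :: "'b \<Rightarrow> 'b \<Rightarrow> real"
    and f :: "'a \<Rightarrow> 'b" and \<eta> \<eta>' :: "real \<Rightarrow> real"
    and \<Phi>1 \<Phi>2 :: "real \<Rightarrow> real \<Rightarrow> real"
  assumes "semimetric_space X d"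
    and "triangle_function X d \<Phi>1"
    and "semimetric_space Y \<rho>"
    and "homeomorphism {0..} {0..} \<eta> \<eta>'"
    and "quasisymmetric \<eta> X d Y \<rho> f"
    and "f ` X = Y"
    and "half_line_binary \<Phi>2"
    and "sym_mono_zero \<Phi>2"
    and "\<And>l x y. l > 0 \<Longrightarrow> x \<ge> 0 \<Longrightarrow> y \<ge> 0 \<Longrightarrow>
           l * \<Phi>1 x y \<le> \<Phi>1 (l * x) (l * y) \<and> \<Phi>2 (l * x) (l * y) \<le> l * \<Phi>2 x y"
    and "\<And>t1 t2. t1 > 0 \<Longrightarrow> t2 > 0 \<Longrightarrow>
           1 \<le> \<Phi>1 (1 / t1) (1 / t2) \<Longrightarrow> 1 \<le> \<Phi>2 (1 / \<eta> t1) (1 / \<eta> t2)"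
    and "\<And>a. a > 0 \<Longrightarrow> a \<le> \<Phi>2 a 0"
  shows "triangle_function Y \<rho> \<Phi>2"
proof -
  have semX: "\<And>x y. x \<in> X \<Longrightarrow> y \<in> X \<Longrightarrow> x \<noteq> y \<Longrightarrow> 0 < d x y"
    "\<And>x y. x \<in> X \<Longrightarrow> y \<in> X \<Longrightarrow> d x y = d y x"
    using assms(1) unfolding semimetric_space_def by (metis less_eq_real_def)+
  have semY: "\<And>u v. u \<in> Y \<Longrightarrow> v \<in> Y \<Longrightarrow> u \<noteq> v \<Longrightarrow> 0 < \<rho> u v"
    "\<And>u v. u \<in> Y \<Longrightarrow> v \<in> Y \<Longrightarrow> 0 \<le> \<rho> u v"
    "\<And>u v. u \<in> Y \<Longrightarrow> v \<in> Y \<Longrightarrow> \<rho> u v = \<rho> v u"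
    "\<And>u. u \<in> Y \<Longrightarrow> \<rho> u u = 0"
    using assms(3) unfolding semimetric_space_def by (metis less_eq_real_def)+
  have nonneg: "0 \<le> \<Phi>2 a b" if "0 \<le> a" "0 \<le> b" for a b
    using assms(7) that by (simp add: half_line_binary_def)
  have sym: "\<Phi>2 a b = \<Phi>2 b a" if "0 \<le> a" "0 \<le> b" for a b
    using assms(8) that by (simp add: sym_mono_zero_def)
  have "\<rho> (f x) (f y) \<le> \<Phi>2 (\<rho> (f x) (f z)) (\<rho> (f y) (f z))"
    if X: "x \<in> X" "y \<in> X" "z \<in> X" for x y z
  proof -
    have Y: "f x \<in> Y" "f y \<in> Y" "f z \<in> Y"
      using X assms(6) by auto
    \<comment> \<open>The division argument needs three distinct images. If \<open>f z\<close> meets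
      one of two distinct images, one argument of \<open>\<Phi>2\<close> is 0 and the bound
      \<open>a \<le> \<Phi>2 a 0\<close> applies, after a swap of arguments when
      \<open>f z = f x\<close>.\<close>
    consider "f x = f y" | "f x \<noteq> f y" "f z = f y" | "f x \<noteq> f y" "f z = f x"
      | "f x \<noteq> f y" "f x \<noteq> f z" "f y \<noteq> f z" by metis
    then show ?thesis
    proof cases
      case 1
      then show ?thesis using Y semY nonneg by simp
    next
      case 2
      then show ?thesis using Y semY assms(11) by simp
    next
      case 3
      then have "\<rho> (f x) (f y) \<le> \<Phi>2 (\<rho> (f x) (f y)) 0"
        using Y semY assms(11) by simp
      then show ?thesis using 3 Y semY sym by simp
    next
      case 4
      define D where "D = d x y"
      define R where "R = \<rho> (f x) (f y)"
      have pos: "0 < D" "0 < d x z" "0 < d y z" "0 < R"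
        using 4 X Y semX semY unfolding D_def R_def by (metis, metis, metis, metis)
      have "D \<le> \<Phi>1 (d x z) (d y z)"
        using assms(2) X unfolding triangle_function_def D_def by blast
      then have "1 \<le> 1 / D * \<Phi>1 (d x z) (d y z)"
        using pos by (simp add: field_simps)
      also have "\<dots> \<le> \<Phi>1 (1 / D * d x z) (1 / D * d y z)"
        using assms(9)[of "1 / D" "d x z" "d y z"] pos by simp
      \<comment> \<open>Writing the arguments as reciprocals of \<open>D / d x z\<close> and
        \<open>D / d y z\<close> matches the form of the hypothesis linking \<open>\<Phi>1\<close>
        to \<open>\<Phi>2\<close>.\<close>
      finally have "1 \<le> \<Phi>1 (1 / (D / d x z)) (1 / (D / d y z))"
        by simp
      then have "1 \<le> \<Phi>2 (1 / \<eta> (D / d x z)) (1 / \<eta> (D / d y z))"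
        using pos by (intro assms(10)) auto
      also have "\<dots> \<le> \<Phi>2 (\<rho> (f x) (f z) / R) (\<rho> (f y) (f z) / R)"
      proof (rule sym_mono_zero_mono[OF assms(8)])
        note inv_le = quasisymmetric_inverse_le[OF assms(1,3,5)]
        show "0 \<le> 1 / \<eta> (D / d x z)" "1 / \<eta> (D / d x z) \<le> \<rho> (f x) (f z) / R"
          using inv_le[of x y z] X 4 unfolding D_def R_def by auto
        \<comment> \<open>Quasisymmetry compares distances from a common point, here
          \<open>y\<close> instead of \<open>x\<close>, so \<open>D\<close> and \<open>R\<close> are
          first read from that end.\<close>
        have "D = d y x" "R = \<rho> (f y) (f x)"
          using X Y semX semY unfolding D_def R_def by auto
        then show "0 \<le> 1 / \<eta> (D / d y z)" "1 / \<eta> (D / d y z) \<le> \<rho> (f y) (f z) / R"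
          using inv_le[of y x z] X 4 by auto
      qed
      also have "\<dots> \<le> 1 / R * \<Phi>2 (\<rho> (f x) (f z)) (\<rho> (f y) (f z))"
        using assms(9)[of "1 / R" "\<rho> (f x) (f z)" "\<rho> (f y) (f z)"] pos Y semY(2) by simp
      finally show ?thesis
        using pos by (simp add: field_simps flip: R_def)
    qed
  qed
  \<comment> \<open>Surjectivity: every triple in \<open>Y\<close> is the image of a triple in
    \<open>X\<close>.\<close>
  then have "\<forall>u\<in>Y. \<forall>v\<in>Y. \<forall>w\<in>Y. \<rho> u v \<le> \<Phi>2 (\<rho> u w) (\<rho> v w)"
    unfolding assms(6)[symmetric] by blast
  then show ?thesis
    using assms(7,8) by (simp add: triangle_function_def)
qed

end
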